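(* Let $p, n$ be positive integers with $p \geq 2$ and $n \geq 2p+2$. Then $C_n^p$ is equitably $k$-choosable for each integer $k \geq 2p = \Delta(C_n^p)$.
   Context: $C_n$ is the cycle on $n$ vertices and $\Delta$ denotes maximum degree. For a graph $H$, the power $H^p$ has vertex set $V(H)$, with two distinct vertices adjacent if and only if their distance in $H$ is at most $p$. A $k$-assignment $L$ for a graph $G$ assigns to each vertex $v$ a set $L(v)$ of exactly $k$ colors. A proper $L$-coloring is a proper coloring $f$ with $f(v)\in L(v)$ for every $v$; it is equitable if each color is used on at most $\lceil |V(G)|/k\rceil$ vertices. $G$ is equitably $k$-choosable if it has an equitable $L$-coloring for every $k$-assignment $L$. *)

theory Defs
  imports Complex_Main "Graph_Theory.Graph_Theory"
begin

text \<open>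
  A finite simple graph is a \<^locale>\<open>pair_graph\<close>: finite, loop-free, without parallel arcs, and
  with every edge represented by its two opposite arcs.
\<close>

text \<open>
  The length of a shortest walk, i.e. the weighted distance of the library for unit weights;
  it is \<open>\<infinity>\<close> if there is no walk.
\<close>

definition graph_dist :: "'a pair_pre_digraph \<Rightarrow> 'a \<Rightarrow> 'a \<Rightarrow> ereal" where
  "graph_dist H u v = wf_digraph.\<mu> (with_proj H) (\<lambda>_. 1) u v"

definition graph_power :: "'a pair_pre_digraph \<Rightarrow> nat \<Rightarrow> 'a pair_pre_digraph" where
  "graph_power H p = \<lparr> pverts = pverts H,
     parcs = {(u, v). u \<in> pverts H \<and> v \<in> pverts H \<and> u \<noteq> v \<and> graph_dist H u v \<le> ereal (real p)} \<rparr>"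

text \<open>Simple only for \<open>n \<ge> 3\<close>.\<close>

definition cycle_graph :: "nat \<Rightarrow> nat pair_pre_digraph" where
  "cycle_graph n = \<lparr> pverts = {0..<n},
     parcs = {(i, j). i < n \<and> j < n \<and> (j = (i + 1) mod n \<or> i = (j + 1) mod n)} \<rparr>"

text \<open>In a symmetric digraph the out-degree of a vertex is its number of neighbours.\<close>

definition max_degree :: "'a pair_pre_digraph \<Rightarrow> nat" where
  "max_degree G = Max (out_degree (with_proj G) ` pverts G)"

definition k_assignment :: "nat \<Rightarrow> 'a pair_pre_digraph \<Rightarrow> ('a \<Rightarrow> 'c set) \<Rightarrow> bool" where
  "k_assignment k G L \<longleftrightarrow> (\<forall>v\<in>pverts G. finite (L v) \<and> card (L v) = k)"

definition proper_list_coloring ::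
    "'a pair_pre_digraph \<Rightarrow> ('a \<Rightarrow> 'c set) \<Rightarrow> ('a \<Rightarrow> 'c) \<Rightarrow> bool" where
  "proper_list_coloring G L f \<longleftrightarrow>
     (\<forall>v\<in>pverts G. f v \<in> L v) \<and> (\<forall>(u, v)\<in>parcs G. f u \<noteq> f v)"

definition equitable_list_coloring ::
    "nat \<Rightarrow> 'a pair_pre_digraph \<Rightarrow> ('a \<Rightarrow> 'c set) \<Rightarrow> ('a \<Rightarrow> 'c) \<Rightarrow> bool" where
  "equitable_list_coloring k G L f \<longleftrightarrow> proper_list_coloring G L f \<and>
     (\<forall>c. int (card {v \<in> pverts G. f v = c}) \<le> \<lceil>real (card (pverts G)) / real k\<rceil>)"

text \<open>
  The type argument is the type from which the colors are drawn. A statement about all colors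
  has to leave it as a type variable: over a type with fewer than \<open>k\<close> elements there is no
  \<open>k\<close>-assignment.
\<close>

definition equitably_choosable :: "'c itself \<Rightarrow> nat \<Rightarrow> 'a pair_pre_digraph \<Rightarrow> bool" where
  "equitably_choosable _ k G \<longleftrightarrow>
     (\<forall>L :: 'a \<Rightarrow> 'c set. k_assignment k G L \<longrightarrow> (\<exists>f. equitable_list_coloring k G L f))"

lemma pair_graph_cycle_graph:
  assumes "n \<ge> 3"
  shows "pair_graph (cycle_graph n)"
proof -
  have *: "(i + 1) mod n \<noteq> i" if "i < n" for i
    using assms that by (cases "i + 1 = n") auto
  have "parcs (cycle_graph n) \<subseteq> {0..<n} \<times> {0..<n}"
    by (auto simp: cycle_graph_def)
  then have fin: "finite (parcs (cycle_graph n))"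
    by (rule finite_subset) auto
  show ?thesis
  proof
    fix e assume "e \<in> parcs (cycle_graph n)"
    then show "fst e \<noteq> snd e"
      using * by (fastforce simp: cycle_graph_def)
  next
    show "symmetric (with_proj (cycle_graph n))"
      by (auto simp: symmetric_def cycle_graph_def intro!: symI)
  qed (use fin in \<open>auto simp: cycle_graph_def\<close>)
qed

lemma graph_dist_sym:
  assumes "pair_graph H"
  shows "graph_dist H u v = graph_dist H v u"
proof -
  interpret pair_graph H by fact
  have le: "\<mu> (\<lambda>_. 1) a b \<le> \<mu> (\<lambda>_. 1) b a" for a b
    unfolding \<mu>_def
  proof (rule INF_greatest)
    fix q assume "q \<in> {q. awalk b q a}"
    then have "awalk a (rev_path q) b"
      by (auto intro: awalk_rev_path')
    moreover have "awalk_cost (\<lambda>_. 1) (rev_path q) = awalk_cost (\<lambda>_. 1) q"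
      by (induction q) auto
    ultimately show "(INF p\<in>{p. awalk a p b}. ereal (awalk_cost (\<lambda>_. 1) p))
        \<le> ereal (awalk_cost (\<lambda>_. 1) q)"
      by (metis (mono_tags, lifting) INF_lower mem_Collect_eq)
  qed
  show ?thesis
    unfolding graph_dist_def by (intro antisym le)
qed

lemma pair_graph_graph_power:
  assumes "pair_graph H"
  shows "pair_graph (graph_power H p)"
proof -
  interpret H: pair_graph H by fact
  have "parcs (graph_power H p) \<subseteq> pverts H \<times> pverts H"
    by (auto simp: graph_power_def)
  then have fin: "finite (parcs (graph_power H p))"
    by (rule finite_subset) auto
  show ?thesis
  proof
    show "symmetric (with_proj (graph_power H p))"
      using graph_dist_sym[OF assms]
      by (auto simp: symmetric_def graph_power_def intro!: symI)
  qed (use fin in \<open>auto simp: graph_power_def\<close>)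
qed

end

theory Submission
  imports Defs "HOL-Number_Theory.Cong"
begin

text \<open>
  Color the first \<open>n - k\<close> vertices greedily, so that any \<open>k\<close> consecutive ones get distinct colors,
  and the remaining \<open>k\<close> by distinct representatives of the colors still available. The available
  sets are large enough except possibly for \<open>k = 2 * p\<close>, when the two middle vertices of the block
  may have the same \<open>2 * p - 1\<close> colors left. If the lists are not constant, we rotate the cycle so
  that these two vertices have different lists and forbid one color at the vertex after the block; if
  they are constant, we let the two ends of the path receive different colors.
\<close>

section \<open>Systems of distinct representatives\<close>

text \<open>
  Under the size condition the members of \<open>S\<close>, taken by increasing size of \<open>A\<close>, can be served
  greedily; since infinite sets have cardinality 0, it also forces all \<open>A v\<close> to be finite.
\<close>

lemma distinct_representatives:
  fixes A :: "'a \<Rightarrow> 'c set"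
  assumes "finite S" and "\<And>t. card {v \<in> S. card (A v) \<le> t} \<le> t"
  shows "\<exists>h. inj_on h S \<and> (\<forall>v\<in>S. h v \<in> A v)"
  using assms
proof (induction S rule: finite_ranking_induct[where f = "\<lambda>v. card (A v)"])
  case empty
  then show ?case by simp
next
  case (insert x S)
  note sizes = insert.prems
  show ?case
  proof (cases "x \<in> S")
    case True
    then show ?thesis using insert by (simp add: insert_absorb)
  next
    case False
    have "card {v \<in> S. card (A v) \<le> t} \<le> t" for t
      by (rule order_trans[OF card_mono sizes]) (use \<open>finite S\<close> in auto)
    then obtain h where h: "inj_on h S" "\<forall>v\<in>S. h v \<in> A v"
      using insert.IH by blast
    have "{v \<in> insert x S. card (A v) \<le> card (A x)} = insert x S"
      using insert.hyps(2) by auto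
    then have "Suc (card S) \<le> card (A x)"
      using sizes[of "card (A x)"] False \<open>finite S\<close> by simp
    then have "\<not> A x \<subseteq> h ` S"
      using card_mono[of "h ` S" "A x"] card_image[OF h(1)] \<open>finite S\<close> by auto
    then obtain c where "c \<in> A x" "c \<notin> h ` S" by blast
    then have "inj_on (h(x := c)) (insert x S) \<and> (\<forall>v\<in>insert x S. (h(x := c)) v \<in> A v)"
      using h False by (auto simp: inj_on_def)
    then show ?thesis by blast
  qed
qed

text \<open>An augmentation of length two: if every color of \<open>A w\<close> is taken, then
  \<open>A w = h\<close> S\<open>by size, so\<close>A u\<open>has a color outside\<close>h
  \<open>S\<close>. Moving \<open>u\<close> there frees its old color for \<open>w\<close>.\<close>

lemma distinct_representatives_insert:
  fixes A :: "'a \<Rightarrow> 'c set"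
  assumes "finite S" "inj_on h S" "\<forall>v\<in>S. h v \<in> A v" "w \<notin> S" "u \<in> S"
    and "card S \<le> card (A u)" "card S \<le> card (A w)" "card S < card (A w) \<or> A u \<noteq> A w"
  shows "\<exists>g. inj_on g (insert w S) \<and> (\<forall>v\<in>insert w S. g v \<in> A v)"
proof (cases "A w \<subseteq> h ` S")
  case False
  then obtain c where "c \<in> A w" "c \<notin> h ` S" by blast
  then have "inj_on (h(w := c)) (insert w S) \<and> (\<forall>v\<in>insert w S. (h(w := c)) v \<in> A v)"
    using assms(2-4) by (auto simp: inj_on_def)
  then show ?thesis by blast
next
  case True
  have hS: "card (h ` S) = card S" by (rule card_image[OF assms(2)])
  have Aw: "A w = h ` S"
    by (rule card_seteq) (use True assms(1,7) hS in auto)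
  then have "A u \<noteq> h ` S" using assms(8) hS by auto
  then have "\<not> A u \<subseteq> h ` S"
    using card_seteq[of "h ` S" "A u"] assms(1,6) hS by auto
  then obtain c where c: "c \<in> A u" "c \<notin> h ` S" by blast
  have "inj_on (h(u := c, w := h u)) (insert w S) \<and>
      (\<forall>v\<in>insert w S. (h(u := c, w := h u)) v \<in> A v)"
    using assms(2-5) c Aw by (auto simp: inj_on_def)
  then show ?thesis by blast
qed

section \<open>Bounded list colorings of powers of paths\<close>

text \<open>For \<open>k > 0\<close> the bound \<open>(m + k - 1) div k\<close> is the ceiling of
  \<open>m / k\<close>, kept in the naturals so that color classes can be counted without
  reals.\<close>

definition path_coloring :: "nat \<Rightarrow> nat \<Rightarrow> nat \<Rightarrow> (nat \<Rightarrow> 'c set) \<Rightarrow> (nat \<Rightarrow> 'c) \<Rightarrow> bool" where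
  "path_coloring p k m L f \<longleftrightarrow> (\<forall>i<m. f i \<in> L i) \<and>
     (\<forall>i j. i < j \<longrightarrow> j < m \<longrightarrow> j \<le> i + p \<longrightarrow> f i \<noteq> f j) \<and>
     (\<forall>c. card {i. i < m \<and> f i = c} \<le> (m + k - 1) div k)"

definition cycle_coloring :: "nat \<Rightarrow> nat \<Rightarrow> nat \<Rightarrow> (nat \<Rightarrow> 'c set) \<Rightarrow> (nat \<Rightarrow> 'c) \<Rightarrow> bool" where
  "cycle_coloring p k n L f \<longleftrightarrow> (\<forall>i<n. f i \<in> L i) \<and>
     (\<forall>i<n. \<forall>d\<in>{1..p}. f i \<noteq> f ((i + d) mod n)) \<and>
     (\<forall>c. card {i. i < n \<and> f i = c} \<le> (n + k - 1) div k)"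

text \<open>Cut the positions into intervals of length \<open>k\<close>. A color occurs at most once
  in each, so \<open>i div k\<close> is injective on a color class, and the bound counts the
  intervals that meet the path.\<close>

lemma card_color_class_window:
  fixes f :: "nat \<Rightarrow> 'c"
  assumes "k > 0" and "\<And>i j. i < j \<Longrightarrow> j < m \<Longrightarrow> j < i + k \<Longrightarrow> f i \<noteq> f j"
  shows "card {i. i < m \<and> f i = c} \<le> (m + k - 1) div k"
proof -
  have inj: "inj_on (\<lambda>i. i div k) {i. i < m \<and> f i = c}"
  proof (rule linorder_inj_onI')
    fix i j assume ij: "i \<in> {i. i < m \<and> f i = c}" "j \<in> {i. i < m \<and> f i = c}" "i < j"
    then have "\<not> j < i + k" using assms(2)[of i j] by auto
    then have "i + k \<le> j" by simp
    then have "(i + k) div k \<le> j div k" by (rule div_le_mono)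
    then show "i div k \<noteq> j div k" using \<open>k > 0\<close> by simp
  qed
  have "i div k < (m + k - 1) div k" if "i < m" for i
  proof -
    have "(i + k) div k \<le> (m + k - 1) div k" using that by (intro div_le_mono) simp
    then show ?thesis using \<open>k > 0\<close> by simp
  qed
  then have "(\<lambda>i. i div k) ` {i. i < m \<and> f i = c} \<subseteq> {..<(m + k - 1) div k}" by auto
  from card_inj_on_le[OF inj this] show ?thesis by simp
qed

text \<open>At most \<open>k - 1\<close> earlier positions lie in the window of a new one, so a list
  of size \<open>k\<close> always has a free color. Position 0 has no predecessors and is content
  with any nonempty list; this leaves room to forbid a color there.\<close>

lemma greedy_window_coloring:
  fixes L :: "nat \<Rightarrow> 'c set"
  assumes "k > 0" "L 0 \<noteq> {}" "\<And>i. 0 < i \<Longrightarrow> i < m \<Longrightarrow> k \<le> card (L i)"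
  shows "\<exists>f. (\<forall>i<m. f i \<in> L i) \<and> (\<forall>i j. i < j \<longrightarrow> j < m \<longrightarrow> j < i + k \<longrightarrow> f i \<noteq> f j)"
  using assms(3)
proof (induction m)
  case 0
  then show ?case by simp
next
  case (Suc m)
  then obtain f where f: "\<forall>i<m. f i \<in> L i" "\<forall>i j. i < j \<longrightarrow> j < m \<longrightarrow> j < i + k \<longrightarrow> f i \<noteq> f j"
    by (metis less_SucI)
  have "\<not> L m \<subseteq> f ` {m + 1 - k..<m}"
  proof (cases "m = 0")
    case True
    then show ?thesis using assms(2) by simp
  next
    case False
    then have "k \<le> card (L m)" using Suc.prems by simp
    moreover have "card (f ` {m + 1 - k..<m}) \<le> m - (m + 1 - k)"
      by (rule order_trans[OF card_image_le]) auto
    then have "card (f ` {m + 1 - k..<m}) < k" using \<open>k > 0\<close> by linarith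
    ultimately show ?thesis
      by (meson card_mono finite_atLeastLessThan finite_imageI leD order_trans)
  qed
  then obtain c where c: "c \<in> L m" "c \<notin> f ` {m + 1 - k..<m}" by blast
  have "f i \<noteq> c" if "i < m" "m < i + k" for i
    using c(2) that by fastforce
  then have "(\<forall>i<Suc m. (f(m := c)) i \<in> L i) \<and>
    (\<forall>i j. i < j \<longrightarrow> j < Suc m \<longrightarrow> j < i + k \<longrightarrow> (f(m := c)) i \<noteq> (f(m := c)) j)"
    using f c(1) by (auto simp: less_Suc_eq)
  then show ?case by blast
qed

lemma path_coloring_exists:
  fixes L :: "nat \<Rightarrow> 'c set"
  assumes "p < k" "L 0 \<noteq> {}" "\<And>i. 0 < i \<Longrightarrow> i < m \<Longrightarrow> k \<le> card (L i)"
  shows "\<exists>f. path_coloring p k m L f"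
proof -
  have k: "k > 0" using assms(1) by simp
  obtain f where f: "\<forall>i<m. f i \<in> L i" "\<And>i j. i < j \<Longrightarrow> j < m \<Longrightarrow> j < i + k \<Longrightarrow> f i \<noteq> f j"
    using greedy_window_coloring[of k L m, OF k assms(2,3)] by blast
  then have "path_coloring p k m L f"
    unfolding path_coloring_def using card_color_class_window[of k m f, OF k f(2)] assms(1) by auto
  then show ?thesis by blast
qed

text \<open>With one list for all vertices, repeating its \<open>k\<close> colors periodically
  separates the ends unless \<open>m mod k = 1\<close>; in that case recoloring the last vertex
  alone suffices.\<close>

lemma path_coloring_distinct_ends:
  fixes C :: "'c set"
  assumes "p + 1 < k" "card C = k" "2 \<le> m"
  shows "\<exists>f. path_coloring p k m (\<lambda>_. C) f \<and> f 0 \<noteq> f (m - 1)"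
proof -
  have k: "k > 0" using assms(1) by simp
  then have "finite C" using assms(2) card_gt_0_iff by fastforce
  then obtain e where "bij_betw e {0..<k} C"
    using ex_bij_betw_nat_finite assms(2) by blast
  then have e: "inj_on e {0..<k}" "\<And>x. x < k \<Longrightarrow> e x \<in> C"
    by (auto simp: bij_betw_def)
  have e_eq: "e (i mod k) = e (j mod k) \<longleftrightarrow> i mod k = j mod k" for i j
    using e(1) k by (auto simp: inj_on_def)
  have periodic: "e (i mod k) \<noteq> e (j mod k)" if "i < j" "j < i + k" for i j
  proof
    assume "e (i mod k) = e (j mod k)"
    then have "k dvd j - i" using e_eq that(1) by (metis less_imp_le mod_eq_dvd_iff_nat)
    then show False using that by (auto dest: dvd_imp_le)
  qed
  show ?thesis
  proof (cases "m mod k = 1")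
    case False
    define f where "f i = e (i mod k)" for i
    have "(m - 1) mod k \<noteq> 0"
    proof
      assume "(m - 1) mod k = 0"
      then have "(m - 1 + 1) mod k = (0 + 1) mod k" by (metis mod_add_left_eq)
      then show False using False assms(1,3) by simp
    qed
    then have "f 0 \<noteq> f (m - 1)" unfolding f_def e_eq by simp
    moreover have "path_coloring p k m (\<lambda>_. C) f"
      unfolding path_coloring_def
      using card_color_class_window[of k m f] periodic e(2) k assms(1) unfolding f_def by auto
    ultimately show ?thesis by blast
  next
    case mod1: True
    define q where "q = m div k"
    have m: "m = q * k + 1" using mod1 unfolding q_def by (metis div_mult_mod_eq)
    \<comment> \<open>The periodic coloring would give both ends the color \<open>e 0\<close>; the previous use of \<open>e 1\<close> is
      \<open>k - 1 > p\<close> positions before the end.\<close>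
    define f where "f i = (if i = m - 1 then e 1 else e (i mod k))" for i
    have "f 0 \<noteq> f (m - 1)"
      using e_eq[of 0 1] assms(1,3) by (simp add: f_def)
    moreover have "card {i. i < m \<and> f i = c} \<le> (m + k - 1) div k" for c
    proof -
      \<comment> \<open>The first \<open>m - 1 = q * k\<close> positions use each color at most
        \<open>q\<close> times, and the recolored one adds at most 1, which the bound
        \<open>Suc q\<close> for \<open>m\<close> positions allows.\<close>
      have "{i. i < m \<and> f i = c} \<subseteq> insert (m - 1) {i. i < m - 1 \<and> e (i mod k) = c}"
        by (auto simp: f_def)
      then have "card {i. i < m \<and> f i = c} \<le> card (insert (m - 1) {i. i < m - 1 \<and> e (i mod k) = c})"
        by (rule card_mono[rotated]) simp
      also have "\<dots> = Suc (card {i. i < m - 1 \<and> e (i mod k) = c})" by simp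
      also have "\<dots> \<le> Suc ((m - 1 + k - 1) div k)"
        using card_color_class_window[of k "m - 1" "\<lambda>i. e (i mod k)" c] k periodic by auto
      also have "(m - 1 + k - 1) div k = q" using m k by (intro div_nat_eqI) (auto simp: algebra_simps)
      also have "Suc q = (m + k - 1) div k" using m k by simp
      finally show ?thesis .
    qed
    moreover have "f i \<noteq> f j" if "i < j" "j < m" "j \<le> i + p" for i j
    proof (cases "j = m - 1")
      case False
      then show ?thesis using periodic[of i j] that assms(1) by (auto simp: f_def)
    next
      case True
      \<comment> \<open>The last vertex carries the color that the periodic pattern has one position
        further on, at \<open>j + 1 = m\<close>. Its distance from \<open>i\<close> is at most
        \<open>p + 1 < k\<close>.\<close>
      have "(j + 1) mod k = 1 mod k" using m True mod1 that(2) assms(1) by simp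
      then have "e (1 mod k) = e ((j + 1) mod k)" unfolding e_eq by simp
      moreover have "e (i mod k) \<noteq> e ((j + 1) mod k)"
        using periodic[of i "j + 1"] that assms(1) by simp
      ultimately show ?thesis using that True assms(1) by (auto simp: f_def)
    qed
    ultimately have "path_coloring p k m (\<lambda>_. C) f \<and> f 0 \<noteq> f (m - 1)"
      using e(2) k assms(1) by (auto simp: path_coloring_def f_def)
    then show ?thesis by blast
  qed
qed

section \<open>Closing the path to a cycle by a block of \<open>k\<close> vertices\<close>

text \<open>The block gets pairwise different colors, so only conflicts with the path matter, and
  each color class grows by at most 1, as does the bound. Block vertex \<open>j\<close> loses at
  most \<open>p - j\<close> colors to the end of the path and \<open>p + j + 1 - k\<close> to its
  beginning, in truncated subtraction; as \<open>2 * p \<le> k\<close>, at most one of these is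
  positive.\<close>

lemma cycle_coloring_extend:
  fixes L :: "nat \<Rightarrow> 'c set"
  assumes "0 < p" "2 * p \<le> k" "0 < m"
    and L: "\<And>i. i < m + k \<Longrightarrow> finite (L i) \<and> card (L i) = k"
    and f: "path_coloring p k m L f"
    and mid: "2 * p < k \<or> L (m + p - 1) - {f (m - 1)} \<noteq> L (m + p) - {f 0}"
  shows "\<exists>g. cycle_coloring p k (m + k) L g"
proof -
  \<comment> \<open>\<open>N j\<close> contains the positions below \<open>m\<close> within cyclic distance \<open>p\<close> of \<open>m + j\<close>.\<close>
  define N where "N j = {m + j - p..<m} \<union> {..<p + j + 1 - k}" for j
  define A where "A j = L (m + j) - f ` N j" for j
  have card_A: "k \<le> card (A j) + ((p - j) + (p + j + 1 - k))" if "j < k" for j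
  proof -
    have "card (f ` N j) \<le> card (N j)" by (rule card_image_le) (simp add: N_def)
    also have "\<dots> \<le> (p - j) + (p + j + 1 - k)"
      unfolding N_def by (rule order_trans[OF card_Un_le]) auto
    finally have "card (f ` N j) \<le> (p - j) + (p + j + 1 - k)" .
    moreover have "card (L (m + j)) - card (f ` N j) \<le> card (A j)"
      unfolding A_def by (rule diff_card_le_card_Diff) (simp add: N_def)
    moreover have "card (L (m + j)) = k" using L that by simp
    ultimately show ?thesis by linarith
  qed
  \<comment> \<open>For \<open>k = 2 * p\<close> the lower bounds on the sizes are
    \<open>p, ..., 2 * p - 1, 2 * p - 1, ..., p\<close>: the size condition may fail only at
    \<open>t = k - 1\<close>. Leaving out the middle vertex \<open>p\<close> repairs it.\<close>
  have "card {j \<in> {..<k} - {p}. card (A j) \<le> t} \<le> t" for t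
  proof (cases "t \<le> k - 2")
    case True
    \<comment> \<open>By \<open>card_A\<close>, a set of size at most \<open>t\<close> can occur
      only among the first \<open>s\<close> and the last \<open>s\<close> block vertices;
      \<open>2 * s \<le> t\<close> follows from \<open>t \<le> k - 2\<close> and
      \<open>2 * p \<le> k\<close>.\<close>
    define s where "s = t + p + 1 - k"
    have "{j \<in> {..<k} - {p}. card (A j) \<le> t} \<subseteq> {..<s} \<union> {k - s..<k}"
    proof
      fix j assume "j \<in> {j \<in> {..<k} - {p}. card (A j) \<le> t}"
      then show "j \<in> {..<s} \<union> {k - s..<k}"
        using card_A[of j] True assms(1,2) unfolding s_def by auto
    qed
    then have "card {j \<in> {..<k} - {p}. card (A j) \<le> t} \<le> card ({..<s} \<union> {k - s..<k})"
      by (rule card_mono[rotated]) simp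
    also have "\<dots> \<le> s + s"
      by (rule order_trans[OF card_Un_le]) auto
    also have "\<dots> \<le> t" using True assms(1,2) unfolding s_def by linarith
    finally show ?thesis .
  next
    case False
    have "card {j \<in> {..<k} - {p}. card (A j) \<le> t} \<le> card ({..<k} - {p})"
      by (rule card_mono) auto
    also have "\<dots> = k - 1" using assms(1,2) by simp
    finally show ?thesis using False by simp
  qed
  then obtain h0 where h0: "inj_on h0 ({..<k} - {p})" "\<forall>j\<in>{..<k} - {p}. h0 j \<in> A j"
    using distinct_representatives[of "{..<k} - {p}" A] by auto
  have card_S: "card ({..<k} - {p}) = k - 1" using assms(1,2) by simp
  have ins: "insert p ({..<k} - {p}) = {..<k}" using assms(1,2) by auto
  \<comment> \<open>If \<open>2 * p < k\<close>, vertex \<open>p\<close> of the block has no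
    neighbor on the path and keeps all \<open>k\<close> colors. If \<open>k = 2 * p\<close>, the
    middle vertices \<open>p - 1\<close> and \<open>p\<close> see only \<open>m - 1\<close> and
    \<open>0\<close> respectively, which is the situation of \<open>mid\<close>.\<close>
  have "k - 1 < card (A p) \<or> A (p - 1) \<noteq> A p"
  proof (cases "2 * p < k")
    case True
    then show ?thesis using card_A[of p] assms(1) by auto
  next
    case False
    then have k: "k = 2 * p" using assms(2) by simp
    have "N (p - 1) = {m - 1}" "N p = {0}" using assms(1,3) unfolding N_def k by auto
    moreover have "m + (p - 1) = m + p - 1" using assms(1) by simp
    ultimately show ?thesis using mid False by (simp add: A_def)
  qed
  then have "\<exists>h. inj_on h (insert p ({..<k} - {p})) \<and> (\<forall>v\<in>insert p ({..<k} - {p}). h v \<in> A v)"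
  proof (intro distinct_representatives_insert[OF _ h0, where u = "p - 1"], unfold card_S)
    show "k - 1 \<le> card (A (p - 1))" "k - 1 \<le> card (A p)"
      using card_A[of p] card_A[of "p - 1"] assms(1,2) by linarith+
  qed (use assms(1,2) in auto)
  then obtain h where h: "inj_on h {..<k}" "\<And>j. j < k \<Longrightarrow> h j \<in> A j"
    unfolding ins by auto
  define g where "g i = (if i < m then f i else h (i - m))" for i
  have h_eq: "h i = h j \<longleftrightarrow> i = j" if "i < k" "j < k" for i j
    using h(1) that by (auto simp: inj_on_def)
  have h_N: "f i \<noteq> h j" if "i \<in> N j" "j < k" for i j
    using h(2)[OF that(2)] imageI[OF that(1), of f] by (auto simp: A_def)
  have "g i \<in> L i" if "i < m + k" for i
    using f h(2)[of "i - m"] that by (auto simp: g_def path_coloring_def A_def)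
  moreover have "g i \<noteq> g ((i + d) mod (m + k))" if "i < m + k" "d \<in> {1..p}" for i d
  proof (cases "i + d < m + k")
    case True
    consider "i + d < m" | "i < m" "m \<le> i + d" | "m \<le> i" by linarith
    then show ?thesis
    proof cases
      case 1
      then show ?thesis using f that by (auto simp: g_def path_coloring_def)
    next
      case 2
      then have "i \<in> N (i + d - m)" using that by (auto simp: N_def)
      then show ?thesis using 2 True h_N[of i "i + d - m"] by (auto simp: g_def)
    next
      case 3
      then show ?thesis using True that h_eq[of "i - m" "i + d - m"] by (auto simp: g_def)
    qed
  next
    case False
    have i: "m \<le> i" "i - m < k" using False that assms(1,2) by auto
    have eq: "(i + d) mod (m + k) = i + d - (m + k)"
      using False that assms(1,2) by (subst mod_if) auto
    show ?thesis
    proof (cases "i + d - (m + k) < m")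
      case True
      have "i + d - (m + k) \<in> N (i - m)" using that False i by (auto simp: N_def)
      then show ?thesis using True i that h_N[of "i + d - (m + k)" "i - m"]
        unfolding eq by (auto simp: g_def)
    next
      \<comment> \<open>When the path is shorter than \<open>p\<close>, an edge can jump over all of
        it and end in the block again; injectivity of \<open>h\<close> handles it.\<close>
      case ge: False
      then show ?thesis using i that False assms(1,2) h_eq[of "i - m" "i + d - (m + k) - m"]
        unfolding eq by (auto simp: g_def)
    qed
  qed
  moreover have "card {i. i < m + k \<and> g i = c} \<le> (m + k + k - 1) div k" for c
  proof -
    let ?B = "{i. m \<le> i \<and> i < m + k \<and> g i = c}"
    have "x = y" if "x \<in> ?B" "y \<in> ?B" for x y
    proof -
      have "h (x - m) = h (y - m)" "x - m < k" "y - m < k" "m \<le> x" "m \<le> y"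
        using that by (auto simp: g_def)
      then show ?thesis using h_eq[of "x - m" "y - m"] by simp
    qed
    then have B: "card ?B \<le> 1"
      unfolding One_nat_def by (subst card_le_Suc0_iff_eq) auto
    have "{i. i < m + k \<and> g i = c} = {i. i < m \<and> f i = c} \<union> ?B"
      by (auto simp: g_def)
    then have "card {i. i < m + k \<and> g i = c} \<le> card {i. i < m \<and> f i = c} + card ?B"
      by (simp add: card_Un_le)
    also have "\<dots> \<le> (m + k - 1) div k + 1"
      using f B by (intro add_mono) (auto simp: path_coloring_def)
    also have "\<dots> = ((m + k - 1) + k) div k" using assms(1,2) by (subst div_add_self2) auto
    also have "(m + k - 1) + k = m + k + k - 1" using assms(3) by simp
    finally show ?thesis .
  qed
  ultimately have "cycle_coloring p k (m + k) L g"
    unfolding cycle_coloring_def by blast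
  then show ?thesis by blast
qed

section \<open>Rotation and existence of the coloring on the cycle\<close>

lemma cycle_coloring_rotate:
  fixes L :: "nat \<Rightarrow> 'c set"
  assumes "\<exists>g. cycle_coloring p k n (\<lambda>i. L ((i + r) mod n)) g"
  shows "\<exists>f. cycle_coloring p k n L f"
proof (cases "n = 0")
  case True
  then show ?thesis by (simp add: cycle_coloring_def)
next
  case False
  obtain g where g: "cycle_coloring p k n (\<lambda>i. L ((i + r) mod n)) g" using assms by blast
  \<comment> \<open>A natural number representing \<open>- r\<close> modulo \<open>n\<close>, so
    that shifting by \<open>t\<close> undoes the rotation.\<close>
  define t where "t = n - r mod n"
  define f where "f i = g ((i + t) mod n)" for i
  have rt: "(i + t + r) mod n = i mod n" for i
  proof -
    have "(i + t + r) mod n = (i + (t + r mod n)) mod n"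
      by (metis add.assoc mod_add_right_eq)
    also have "t + r mod n = n" using False unfolding t_def by simp
    finally show ?thesis by simp
  qed
  have "f i \<in> L i" if "i < n" for i
  proof -
    have "g ((i + t) mod n) \<in> L (((i + t) mod n + r) mod n)"
      using g False by (simp add: cycle_coloring_def)
    then show ?thesis using rt[of i] that by (simp add: f_def mod_add_left_eq)
  qed
  moreover have "f i \<noteq> f ((i + d) mod n)" if "i < n" "d \<in> {1..p}" for i d
  proof -
    have "g ((i + t) mod n) \<noteq> g (((i + t) mod n + d) mod n)"
      using g False that by (simp add: cycle_coloring_def)
    then show ?thesis by (simp add: f_def mod_simps add_ac)
  qed
  moreover have "card {i. i < n \<and> f i = c} \<le> (n + k - 1) div k" for c
  proof -
    have "inj_on (\<lambda>i. (i + t) mod n) {i. i < n \<and> f i = c}"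
    proof (rule inj_onI)
      fix i j assume "i \<in> {i. i < n \<and> f i = c}" "j \<in> {i. i < n \<and> f i = c}"
        "(i + t) mod n = (j + t) mod n"
      then show "i = j"
        using cong_add_rcancel_nat[of i t j n] by (auto simp: cong_def)
    qed
    moreover have "(\<lambda>i. (i + t) mod n) ` {i. i < n \<and> f i = c} \<subseteq> {i. i < n \<and> g i = c}"
      using False by (auto simp: f_def)
    ultimately have "card {i. i < n \<and> f i = c} \<le> card {i. i < n \<and> g i = c}"
      by (rule card_inj_on_le) simp
    also have "\<dots> \<le> (n + k - 1) div k" using g by (simp add: cycle_coloring_def)
    finally show ?thesis .
  qed
  ultimately have "cycle_coloring p k n L f" unfolding cycle_coloring_def by blast
  then show ?thesis by blast
qed

lemma cycle_coloring_exists: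
  fixes L :: "nat \<Rightarrow> 'c set"
  assumes p: "2 \<le> p" and n: "2 * p + 2 \<le> n" and k: "2 * p \<le> k"
    and L: "\<And>i. i < n \<Longrightarrow> finite (L i) \<and> card (L i) = k"
  shows "\<exists>f. cycle_coloring p k n L f"
proof (cases "n \<le> k")
  case True
  \<comment> \<open>With at most \<open>k\<close> vertices a window of length \<open>k\<close>
    covers everything, so the greedy coloring is injective.\<close>
  have "L 0 \<noteq> {}" using L[of 0] p n k by auto
  moreover have "k \<le> card (L i)" if "0 < i" "i < n" for i using L that by simp
  ultimately obtain f where f: "\<forall>i<n. f i \<in> L i" "\<And>i j. i < j \<Longrightarrow> j < n \<Longrightarrow> j < i + k \<Longrightarrow> f i \<noteq> f j"
    using greedy_window_coloring[of k L n] p k by auto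
  have ne: "f i \<noteq> f j" if "i < n" "j < n" "i \<noteq> j" for i j
    using f(2)[of i j] f(2)[of j i] that True by (cases "i < j") auto
  have "f i \<noteq> f ((i + d) mod n)" if "i < n" "d \<in> {1..p}" for i d
  proof (rule ne)
    show "i \<noteq> (i + d) mod n"
      using that n by (cases "i + d < n") (auto simp: mod_if)
  qed (use that in auto)
  then have "cycle_coloring p k n L f"
    unfolding cycle_coloring_def using card_color_class_window[of k n f, OF _ f(2)] f(1) p k by auto
  then show ?thesis by blast
next
  case False
  define m where "m = n - k"
  have m: "n = m + k" "0 < m" using False by (auto simp: m_def)
  show ?thesis
  proof (cases "\<forall>i<n. L i = L ((i + 1) mod n)")
    case False
    then obtain s where s: "s < n" "L s \<noteq> L ((s + 1) mod n)" by blast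
    \<comment> \<open>The rotation moves the pair \<open>s\<close>, \<open>s + 1\<close> with
      different lists to the middle positions \<open>m + p - 1\<close> and \<open>m + p\<close> of
      the block.\<close>
    define r where "r = s + n - (m + p - 1)"
    define M where "M i = L ((i + r) mod n)" for i
    have mp: "m + p - 1 < n" using m k p by auto
    have M: "finite (M i) \<and> card (M i) = k" for i
      using L m by (simp add: M_def)
    have sr: "m + p - 1 + r = s + n" "m + p + r = s + 1 + n" using mp m p unfolding r_def by auto
    have M1: "M (m + p - 1) = L s" unfolding M_def sr(1) using s(1) by simp
    have M2: "M (m + p) = L ((s + 1) mod n)" unfolding M_def sr(2) mod_add_self2 ..
    \<comment> \<open>Different lists of equal finite size are not nested. If \<open>f 0\<close>
      avoids \<open>c\<close>, then \<open>c\<close> stays available at \<open>m + p\<close> but not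
      at \<open>m + p - 1\<close>, whatever \<open>f (m - 1)\<close> is.\<close>
    have "\<not> M (m + p) \<subseteq> M (m + p - 1)"
      using card_subset_eq[of "M (m + p - 1)" "M (m + p)"] M s(2) M1 M2 by metis
    then obtain c where c: "c \<in> M (m + p)" "c \<notin> M (m + p - 1)" by blast
    have "M 0 - {c} \<noteq> {}"
    proof
      assume "M 0 - {c} = {}"
      then have "card (M 0) \<le> card {c}" by (intro card_mono) auto
      then show False using M[of 0] p k by simp
    qed
    then obtain f where f: "path_coloring p k m (M(0 := M 0 - {c})) f"
      using path_coloring_exists[of p k "M(0 := M 0 - {c})" m] M p k by auto
    have "f 0 \<noteq> c" using f m by (auto simp: path_coloring_def)
    then have "c \<in> M (m + p) - {f 0}" "c \<notin> M (m + p - 1) - {f (m - 1)}" using c by simp_all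
    then have mid: "M (m + p - 1) - {f (m - 1)} \<noteq> M (m + p) - {f 0}" by metis
    have "f i \<in> M i" if "i < m" for i
      using f that by (cases "i = 0") (auto simp: path_coloring_def)
    then have "path_coloring p k m M f"
      using f by (simp add: path_coloring_def)
    then have "\<exists>g. cycle_coloring p k (m + k) M g"
      using M mid p by (intro cycle_coloring_extend[OF _ k m(2)]) auto
    then have "\<exists>g. cycle_coloring p k n (\<lambda>i. L ((i + r) mod n)) g"
      unfolding M_def[abs_def] m(1)[symmetric] .
    then show ?thesis by (rule cycle_coloring_rotate)
  next
    case True
    have const: "L i = L 0" if "i < n" for i
      using that
    proof (induction i)
      case (Suc i)
      then show ?case using True by (metis Suc_eq_plus1 Suc_lessD mod_less)
    qed simp
    have "\<exists>f. path_coloring p k m L f \<and> (2 * p < k \<or> f 0 \<noteq> f (m - 1))"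
    proof (cases "2 * p < k")
      case True
      have "L 0 \<noteq> {}" using L[of 0] p n k by auto
      then show ?thesis using path_coloring_exists[of p k L m] L p k m True by auto
    next
      case False
      \<comment> \<open>Now \<open>k = 2 * p\<close>, so \<open>p \<ge> 2\<close> gives
        \<open>p + 1 < k\<close> and \<open>n \<ge> 2 * p + 2\<close> gives
        \<open>m \<ge> 2\<close>.\<close>
      then obtain f where f: "path_coloring p k m (\<lambda>_. L 0) f" "f 0 \<noteq> f (m - 1)"
        using path_coloring_distinct_ends[of p k "L 0" m] L[of 0] p n k m by auto
      have "f i \<in> L i" if "i < m" for i
        using f(1) const[of i] m that by (simp add: path_coloring_def)
      then have "path_coloring p k m L f"
        using f(1) by (simp add: path_coloring_def)
      then show ?thesis using f(2) by blast
    qed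
    then obtain f where f: "path_coloring p k m L f" "2 * p < k \<or> f 0 \<noteq> f (m - 1)" by blast
    \<comment> \<open>Removing two different members from the same list leaves different
      sets.\<close>
    have "L (m + p - 1) = L 0" "L (m + p) = L 0"
      using const[of "m + p - 1"] const[of "m + p"] m p k by linarith+
    moreover have "m - 1 < m" "L (m - 1) = L 0" using m const[of "m - 1"] by simp_all
    then have "f 0 \<in> L 0" "f (m - 1) \<in> L 0"
      using f(1) m(2) by (auto simp: path_coloring_def)
    ultimately have "2 * p < k \<or> L (m + p - 1) - {f (m - 1)} \<noteq> L (m + p) - {f 0}"
      using f(2) by (metis Diff_iff singletonD singletonI)
    then show ?thesis
      using cycle_coloring_extend[of p k m L f] p k m L f(1) by auto
  qed
qed

section \<open>Translation to the graph: ceilings, distances and degrees in powers of the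
  cycle\<close>

lemma ceiling_divide_nat:
  fixes n k :: nat
  assumes "0 < k"
  shows "int ((n + k - 1) div k) \<le> \<lceil>real n / real k\<rceil>"
proof -
  define q where "q = (n + k - 1) div k"
  have "q * k \<le> n + k - 1" unfolding q_def by simp
  then have "q * k < n + k" using assms by linarith
  then have "real q * real k < real n + real k" by (metis of_nat_add of_nat_less_iff of_nat_mult)
  then have "real q - 1 < real n / real k" using assms by (simp add: field_simps)
  then have "int q - 1 < \<lceil>real n / real k\<rceil>" by (simp add: less_ceiling_iff)
  then show ?thesis unfolding q_def by simp
qed

lemma cycle_graph_dist_le:
  assumes n: "3 \<le> n" and u: "u < n"
  shows "graph_dist (cycle_graph n) u ((u + d) mod n) \<le> ereal (real d)"
proof -
  interpret pair_graph "cycle_graph n" by (rule pair_graph_cycle_graph[OF n])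
  have "\<exists>q. awalk u q ((u + d) mod n) \<and> length q = d"
  proof (induction d)
    case 0
    have "awalk u [] u" unfolding awalk_Nil_iff using u by (simp add: cycle_graph_def)
    then show ?case using u by auto
  next
    case (Suc d)
    then obtain q where q: "awalk u q ((u + d) mod n)" "length q = d" by blast
    let ?e = "((u + d) mod n, (u + Suc d) mod n)"
    have "?e \<in> parcs (cycle_graph n)"
      using n by (auto simp: cycle_graph_def mod_simps)
    then have "awalk ((u + d) mod n) [?e] ((u + Suc d) mod n)"
      using arc_implies_awalk[of ?e] by simp
    from awalk_appendI[OF q(1) this] have "awalk u (q @ [?e]) ((u + Suc d) mod n)" .
    then show ?case using q(2) by (intro exI[of _ "q @ [?e]"]) auto
  qed
  then obtain q where q: "awalk u q ((u + d) mod n)" "length q = d" by blast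
  have "graph_dist (cycle_graph n) u ((u + d) mod n) \<le> ereal (awalk_cost (\<lambda>_. 1) q)"
    unfolding graph_dist_def \<mu>_def by (rule INF_lower) (use q in simp)
  also have "awalk_cost (\<lambda>_. 1) q = real d"
    unfolding q(2)[symmetric] by (induction q) auto
  finally show ?thesis .
qed

text \<open>The witness \<open>z\<close> is the net displacement of the walk: every arc adds 1 or
  -1, and backward arcs are the reason for integers.\<close>

lemma cycle_graph_walk_offset:
  assumes n: "3 \<le> n" and "pre_digraph.awalk (with_proj (cycle_graph n)) u q v"
  shows "\<exists>z. \<bar>z\<bar> \<le> int (length q) \<and> int v = (int u + z) mod int n"
proof -
  interpret pair_graph "cycle_graph n" by (rule pair_graph_cycle_graph[OF n])
  show ?thesis using assms(2)
  proof (induction q arbitrary: u)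
    case Nil
    then have "u = v" "u < n" by (auto simp: awalk_Nil_iff) (simp add: cycle_graph_def)
    then show ?case by (intro exI[of _ 0]) simp
  next
    case (Cons e q)
    obtain a b where e: "e = (a, b)" by (cases e)
    from Cons.prems have w: "a = u" "(u, b) \<in> parcs (cycle_graph n)" "awalk b q v"
      by (auto simp: awalk_Cons_iff e)
    obtain z where z: "\<bar>z\<bar> \<le> int (length q)" "int v = (int b + z) mod int n"
      using Cons.IH[OF w(3)] by blast
    from w(2) consider "b = (u + 1) mod n" | "u = (b + 1) mod n" "b < n"
      by (auto simp: cycle_graph_def)
    then show ?case
    proof cases
      case 1
      then have "int v = (int u + (1 + z)) mod int n"
        using z(2) by (simp add: zmod_int mod_simps add_ac)
      then show ?thesis using z(1) by (intro exI[of _ "1 + z"]) auto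
    next
      case 2
      have "(int u + (z - 1)) mod int n = ((int b + 1) mod int n + (z - 1)) mod int n"
        using 2(1) by (simp add: zmod_int add.commute)
      also have "\<dots> = (int b + 1 + (z - 1)) mod int n" by (rule mod_add_left_eq)
      finally have "int v = (int u + (z - 1)) mod int n"
        using z(2) by simp
      then show ?thesis using z(1) by (intro exI[of _ "z - 1"]) auto
    qed
  qed
qed

lemma cycle_graph_dist_le_iff:
  assumes n: "3 \<le> n" and uv: "u < n" "v < n"
  shows "graph_dist (cycle_graph n) u v \<le> ereal (real p) \<longleftrightarrow>
    (\<exists>d\<le>p. v = (u + d) mod n \<or> u = (v + d) mod n)"
proof
  interpret pair_graph "cycle_graph n" by (rule pair_graph_cycle_graph[OF n])
  assume "graph_dist (cycle_graph n) u v \<le> ereal (real p)"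
  \<comment> \<open>The distance is an infimum, so a strict bound is what yields a walk. Since costs
    are integral, a walk of cost below \<open>p + 1\<close> has length at most
    \<open>p\<close>.\<close>
  then have "graph_dist (cycle_graph n) u v < ereal (real p + 1)"
    by (rule order_le_less_trans) simp
  then obtain q where q: "awalk u q v" "awalk_cost (\<lambda>_. 1) q < real p + 1"
    unfolding graph_dist_def \<mu>_def by (auto simp: INF_less_iff)
  have "awalk_cost (\<lambda>_. 1) q = real (length q)" by (induction q) auto
  then have len: "length q \<le> p" using q(2) by simp
  obtain z where z: "\<bar>z\<bar> \<le> int (length q)" "int v = (int u + z) mod int n"
    using cycle_graph_walk_offset[OF n q(1)] by blast
  have zp: "nat \<bar>z\<bar> \<le> p" using z(1) len by linarith
  show "\<exists>d\<le>p. v = (u + d) mod n \<or> u = (v + d) mod n"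
  proof (cases "0 \<le> z")
    case True
    then have "int v = int ((u + nat \<bar>z\<bar>) mod n)" using z(2) by (simp add: zmod_int)
    then show ?thesis using zp by (metis of_nat_eq_iff)
  next
    case False
    have "int ((v + nat \<bar>z\<bar>) mod n) = ((int u + z) mod int n - z) mod int n"
      using z(2) False by (simp add: zmod_int)
    also have "\<dots> = (int u + z - z) mod int n" by (rule mod_diff_left_eq)
    also have "\<dots> = int u" using uv by simp
    finally show ?thesis using zp by (metis of_nat_eq_iff)
  qed
next
  assume "\<exists>d\<le>p. v = (u + d) mod n \<or> u = (v + d) mod n"
  then obtain d where d: "d \<le> p" "v = (u + d) mod n \<or> u = (v + d) mod n" by blast
  then have "graph_dist (cycle_graph n) u v \<le> ereal (real d)"
    using cycle_graph_dist_le[OF n, of u d] cycle_graph_dist_le[OF n, of v d] uv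
      graph_dist_sym[OF pair_graph_cycle_graph[OF n], of u v] by auto
  also have "\<dots> \<le> ereal (real p)" using d(1) by simp
  finally show "graph_dist (cycle_graph n) u v \<le> ereal (real p)" .
qed

lemma cycle_power_arc_iff:
  assumes "3 \<le> n"
  shows "(u, v) \<in> parcs (graph_power (cycle_graph n) p) \<longleftrightarrow>
    u < n \<and> v < n \<and> u \<noteq> v \<and> (\<exists>d\<in>{1..p}. v = (u + d) mod n \<or> u = (v + d) mod n)"
proof (cases "u < n \<and> v < n \<and> u \<noteq> v")
  case True
  have "(\<exists>d\<le>p. v = (u + d) mod n \<or> u = (v + d) mod n) \<longleftrightarrow>
      (\<exists>d\<in>{1..p}. v = (u + d) mod n \<or> u = (v + d) mod n)"
  proof -
    have "d \<noteq> 0" if "v = (u + d) mod n \<or> u = (v + d) mod n" for d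
      using that True by (cases d) auto
    then show ?thesis by (metis One_nat_def Suc_leI atLeastAtMost_iff neq0_conv)
  qed
  then show ?thesis
    using True cycle_graph_dist_le_iff[OF assms, of u v p]
    by (simp add: graph_power_def) (simp add: cycle_graph_def)
next
  case False
  then show ?thesis by (auto simp: graph_power_def cycle_graph_def)
qed

text \<open>A backward step by \<open>d\<close> is a forward step by \<open>n - d\<close>, so all
  neighbors arise from the forward offsets in \<open>{1..p}\<close> and \<open>{n - p..<n}\<close>.
  These ranges are disjoint as \<open>n \<ge> 2 * p + 1\<close>, and different offsets below
  \<open>n\<close> reach different vertices.\<close>

lemma cycle_power_out_degree:
  assumes p: "1 \<le> p" and n: "2 * p + 1 \<le> n" and u: "u < n"
  shows "out_degree (with_proj (graph_power (cycle_graph n) p)) u = 2 * p"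
proof -
  let ?D = "{1..p} \<union> {n - p..<n}"
  have n3: "3 \<le> n" using p n by simp
  have nz: "(u + d) mod n \<noteq> u" if "0 < d" "d < n" for d
    using that u by (cases "u + d < n") (auto simp: mod_if)
  have neighbours: "v < n \<and> u \<noteq> v \<and> (\<exists>d\<in>{1..p}. v = (u + d) mod n \<or> u = (v + d) mod n) \<longleftrightarrow>
      v \<in> (\<lambda>d. (u + d) mod n) ` ?D" (is "?l \<longleftrightarrow> ?r") for v
  proof
    assume ?l
    then obtain d where v: "v < n" and d: "d \<in> {1..p}" "v = (u + d) mod n \<or> u = (v + d) mod n" by blast
    show ?r
    proof (cases "v = (u + d) mod n")
      case False
      then have "u = (v + d) mod n" using d by blast
      then have "(u + (n - d)) mod n = (v + d + (n - d)) mod n" by (simp add: mod_add_left_eq)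
      also have "v + d + (n - d) = v + n" using d n by auto
      finally have "v = (u + (n - d)) mod n" using v by simp
      moreover have "n - d \<in> ?D" using d n by auto
      ultimately show ?thesis by blast
    qed (use d in blast)
  next
    assume ?r
    then obtain d where d: "d \<in> ?D" "v = (u + d) mod n" by blast
    have "0 < d" "d < n" using d(1) n p by auto
    then have v: "v < n" "u \<noteq> v" using d(2) nz[of d] by auto
    show ?l
    proof (cases "d \<in> {1..p}")
      case False
      then have d': "n - d \<in> {1..p}" "d < n" using d by auto
      have "(v + (n - d)) mod n = (u + d + (n - d)) mod n" using d(2) by (simp add: mod_add_left_eq)
      also have "u + d + (n - d) = u + n" using d' by simp
      finally have "u = (v + (n - d)) mod n" using u by simp
      then show ?thesis using v d' by blast
    qed (use v d in blast)
  qed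
  have "out_arcs (with_proj (graph_power (cycle_graph n) p)) u = Pair u ` (\<lambda>d. (u + d) mod n) ` ?D"
  proof (rule set_eqI)
    fix e :: "nat \<times> nat"
    obtain a v where e: "e = (a, v)" by (cases e)
    show "e \<in> out_arcs (with_proj (graph_power (cycle_graph n) p)) u \<longleftrightarrow>
        e \<in> Pair u ` (\<lambda>d. (u + d) mod n) ` ?D"
      using cycle_power_arc_iff[OF n3, of a v p] neighbours[of v] u
      unfolding e out_arcs_def by auto
  qed
  moreover have "inj_on (\<lambda>d. (u + d) mod n) ?D"
  proof (rule inj_onI)
    fix x y assume "x \<in> ?D" "y \<in> ?D" and eq: "(u + x) mod n = (u + y) mod n"
    then have "x < n" "y < n" using n p by auto
    then show "x = y" using eq cong_add_lcancel_nat[of u x y n] by (auto simp: cong_def)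
  qed
  moreover have "card ?D = 2 * p"
    using n p by (subst card_Un_disjoint) auto
  ultimately show ?thesis
    unfolding out_degree_def by (simp add: card_image inj_on_def)
qed

theorem theorem11:
  fixes p n :: nat
  assumes "p \<ge> 2" and "n \<ge> 2 * p + 2"
  shows "max_degree (graph_power (cycle_graph n) p) = 2 * p \<and>
    (\<forall>k \<ge> 2 * p. equitably_choosable TYPE('c) k (graph_power (cycle_graph n) p))"
proof (intro conjI allI impI)
  let ?G = "graph_power (cycle_graph n) p"
  have verts: "pverts ?G = {0..<n}" by (simp add: graph_power_def cycle_graph_def)
  have n3: "3 \<le> n" using assms by simp
  have "out_degree (with_proj ?G) ` {0..<n} = (\<lambda>_. 2 * p) ` {0..<n}"
    using assms by (intro image_cong) (auto simp: cycle_power_out_degree)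
  also have "\<dots> = {2 * p}" using assms by (simp add: image_constant_conv)
  finally show "max_degree ?G = 2 * p" by (simp add: max_degree_def verts)
  fix k assume k: "2 * p \<le> k"
  show "equitably_choosable TYPE('c) k ?G"
    unfolding equitably_choosable_def
  proof (intro allI impI)
    fix L :: "nat \<Rightarrow> 'c set" assume L: "k_assignment k ?G L"
    obtain f where f: "cycle_coloring p k n L f"
      using cycle_coloring_exists[of p n k L] assms k L by (auto simp: k_assignment_def verts)
    have "f u \<noteq> f v" if "(u, v) \<in> parcs ?G" for u v
      using that f unfolding cycle_power_arc_iff[OF n3] cycle_coloring_def by metis
    moreover have "int (card {v \<in> pverts ?G. f v = c}) \<le> \<lceil>real (card (pverts ?G)) / real k\<rceil>" for c
    proof -
      have "card {v \<in> pverts ?G. f v = c} \<le> (n + k - 1) div k"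
        using f by (simp add: cycle_coloring_def verts)
      then have "int (card {v \<in> pverts ?G. f v = c}) \<le> int ((n + k - 1) div k)" by simp
      also have "\<dots> \<le> \<lceil>real n / real k\<rceil>" using assms k by (intro ceiling_divide_nat) simp
      finally show ?thesis by (simp add: verts)
    qed
    ultimately have "equitable_list_coloring k ?G L f"
      using f by (auto simp: equitable_list_coloring_def proper_list_coloring_def cycle_coloring_def verts)
    then show "\<exists>f. equitable_list_coloring k ?G L f" by blast
  qed
qed

end
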